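(* Consider the problem $$\text{(P)}\qquad \min f(x)\quad\text{s.t.}\quad x\in X,\ \ \|x\|_0\le K,\ \ x_i\in\{0\}\cup[a_i,b_i],\ i=1,\dots,n.$$ Let $x^*$ be a local minimizer of (P). Let $J^*=\{1\le j\le n: x^*_j\ne 0\}$, let $\bar J^*$ be its complement in $\{1,\dots,n\}$, and let $r^*=|J^*|$. Put $$A(x^* )=\{i\in J^*: x_i^*=b_i\},\qquad B(x^* )=\{i\in J^*: x_i^*=a_i\}.$$ Suppose that the Robinson condition $$\left\{\begin{pmatrix} d_{J^*}-s\\ -d_{J^*}-t\\ d_{\bar J^*}\end{pmatrix}\ \Bigg|\ d\in T_X(x^* ),\ s,t\in\mathbb{R}^{r^*},\ s_{A(x^* )}\le 0,\ t_{B(x^* )}\le 0\right\}=\mathbb{R}^{n+r^*}$$ holds, where the entries of $s,t$ are indexed by $J^*$. Then there exists $(\nu^*,\eta^*,\kappa^* )\in\mathbb{R}^n\times\mathbb{R}^n\times\mathbb{R}^n$ such that $$0\in\nabla f(x^* )+\nu^*-\eta^*+\kappa^*+N_X(x^* ),$$ $$\nu_i^*\ge 0,\quad \eta_i^*\ge 0,\quad \nu_i^*(x_i^*-b_i)=0,\quad \eta_i^*(-a_i+x_i^* )=0,\qquad i=1,\dots,n,$$ $$\kappa_j^*=0,\qquad j\in J^*.$$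
   Context: Standing assumptions: $f:\mathbb{R}^n\to\mathbb{R}$ is a continuously differentiable convex function; $X\subseteq\mathbb{R}^n$ is a closed convex set with nonempty interior; $0<K<n$; and $0<a_i<b_i$ for $i=1,\dots,n$. $\|x\|_0$ denotes the number of nonzero entries of $x$. For an index set $L\subseteq\{1,\dots,n\}$, $x_L$ denotes the subvector of $x$ formed by the entries indexed by $L$. $T_X(x)$ and $N_X(x)$ denote the tangent cone and the normal cone of $X$ at $x\in X$. *)

theory Defs
  imports "HOL-Analysis.Analysis"
begin

definition gradient :: "('a::real_inner \<Rightarrow> real) \<Rightarrow> 'a \<Rightarrow> 'a" where
  "gradient f x = (THE D. GDERIV f x :> D)"

lemma gradient_eqI: "gradient f x = D" if D: "GDERIV f x :> D"
  unfolding gradient_def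
proof (rule the_equality)
  fix E assume "GDERIV f x :> E"
  with D have "(\<lambda>h. inner h E) = (\<lambda>h. inner h D)"
    unfolding gderiv_def by (blast intro: has_derivative_unique)
  then show "E = D"
    by (metis inner_commute vector_eq_rdot)
qed (rule D)

lemma GDERIV_gradient: "GDERIV f x :> gradient f x"
  if "f differentiable at x" for f :: "'a::euclidean_space \<Rightarrow> real"
proof -
  from that obtain f' where f': "(f has_derivative f') (at x)"
    by (auto simp: differentiable_def)
  then have "linear f'"
    by (rule has_derivative_linear)
  then have "f' h = inner h (adjoint f' 1)" for h
    by (simp add: adjoint_works)
  with f' have "GDERIV f x :> adjoint f' 1"
    unfolding gderiv_def by (simp add: has_derivative_eq_rhs ext)
  then show ?thesis
    by (simp add: gradient_eqI)
qed

definition continuously_differentiable :: "('a::euclidean_space \<Rightarrow> real) \<Rightarrow> bool" where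
  "continuously_differentiable f \<longleftrightarrow>
     (\<forall>x. f differentiable at x) \<and> continuous_on UNIV (gradient f)"

(* The contingent (Bouligand) cone; for convex X and x in X it is the closure of the cone
   of feasible directions. *)
definition tangent_cone :: "'a::real_normed_vector set \<Rightarrow> 'a \<Rightarrow> 'a set" where
  "tangent_cone X x =
     {d. \<exists>y t. (\<forall>k::nat. y k \<in> X \<and> t k > 0) \<and> t \<longlonglongrightarrow> (0::real) \<and> y \<longlonglongrightarrow> x \<and>
               (\<lambda>k. (y k - x) /\<^sub>R t k) \<longlonglongrightarrow> d}"

(* The normal cone of convex analysis; only meant for convex X and x in X. *)
definition normal_cone :: "'a::real_inner set \<Rightarrow> 'a \<Rightarrow> 'a set" where
  "normal_cone X x = {v. \<forall>y\<in>X. inner v (y - x) \<le> 0}"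

definition support :: "real ^ 'n \<Rightarrow> 'n set" where
  "support x = {i. x $ i \<noteq> 0}"

definition l0_norm :: "real ^ 'n \<Rightarrow> nat" where
  "l0_norm x = card (support x)"

definition local_minimizer :: "('a::metric_space \<Rightarrow> real) \<Rightarrow> 'a set \<Rightarrow> 'a \<Rightarrow> bool" where
  "local_minimizer f S x \<longleftrightarrow>
     x \<in> S \<and> (\<exists>e>0. \<forall>y\<in>S. dist y x < e \<longrightarrow> f x \<le> f y)"

definition feasible_set :: "(real ^ 'n) set \<Rightarrow> nat \<Rightarrow> real ^ 'n \<Rightarrow> real ^ 'n \<Rightarrow> (real ^ 'n) set" where
  "feasible_set X K a b =
     {x \<in> X. l0_norm x \<le> K \<and> (\<forall>i. x $ i \<in> {0} \<union> {a $ i..b $ i})}"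

(* A vector whose entries are indexed by J is an extensional function on J, so that
   (J \<rightarrow>\<^sub>E UNIV) is a copy of the |J|-dimensional real space. With r the cardinality of J,
   the right-hand side is thus the space of dimension r + r + (n - r) = n + r. *)
definition robinson_condition :: "(real ^ 'n) set \<Rightarrow> real ^ 'n \<Rightarrow> real ^ 'n \<Rightarrow> real ^ 'n \<Rightarrow> bool" where
  "robinson_condition X a b x \<longleftrightarrow>
     (let J = support x; A = {i \<in> J. x $ i = b $ i}; B = {i \<in> J. x $ i = a $ i} in
       {(\<lambda>j\<in>J. d $ j - s j, \<lambda>j\<in>J. - d $ j - t j, \<lambda>j\<in>- J. d $ j) | d s t.
          d \<in> tangent_cone X x \<and> s \<in> J \<rightarrow>\<^sub>E UNIV \<and> t \<in> J \<rightarrow>\<^sub>E UNIV \<and>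
          (\<forall>i\<in>A. s i \<le> 0) \<and> (\<forall>i\<in>B. t i \<le> 0)}
       = (J \<rightarrow>\<^sub>E UNIV) \<times> (J \<rightarrow>\<^sub>E UNIV) \<times> (- J \<rightarrow>\<^sub>E UNIV))"

end

theory Submission
  imports Defs
begin

text \<open>
  Near \<open>xs\<close> the problem contains the convex problem of minimizing \<open>f\<close> over \<open>X \<inter> P\<close>, where \<open>P\<close> is the
  box \<open>[a, b]\<close> on the support of \<open>xs\<close> and \<open>0\<close> elsewhere, so \<open>- gradient f xs\<close> is normal to \<open>X \<inter> P\<close>.
  Separating the strict epigraph over \<open>X\<close> of the linearized objective from \<open>P \<times> {..0}\<close> splits it into
  a normal of \<open>X\<close> and a normal \<open>m\<close> of \<open>P\<close>, unless the separating hyperplane is vertical; Robinson's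
  condition excludes that case. The multipliers are the positive part of \<open>m\<close> and its negative part on
  the support, and \<open>m\<close> itself off the support.
\<close>

text \<open>The inequality holds for every difference quotient defining \<open>d\<close> and
  survives the limit. This is the easy half of the polarity of the two cones.\<close>

lemma normal_cone_inner_tangent_cone_le:
  assumes "v \<in> normal_cone X x" and "d \<in> tangent_cone X x"
  shows "v \<bullet> d \<le> 0"
proof -
  obtain y t where yt: "\<And>k::nat. y k \<in> X \<and> t k > (0::real)"
    and lim: "(\<lambda>k. (y k - x) /\<^sub>R t k) \<longlonglongrightarrow> d"
    using assms(2) by (auto simp: tangent_cone_def)
  have "(\<lambda>k. v \<bullet> ((y k - x) /\<^sub>R t k)) \<longlonglongrightarrow> v \<bullet> d"
    by (intro tendsto_intros lim)
  moreover have "v \<bullet> ((y k - x) /\<^sub>R t k) \<le> 0" for k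
  proof -
    have "v \<bullet> (y k - x) \<le> 0"
      using assms(1) yt[of k] by (simp add: normal_cone_def)
    then show ?thesis
      using yt[of k] by (simp add: mult_nonneg_nonpos)
  qed
  ultimately show ?thesis
    by (meson LIMSEQ_le_const2)
qed

text \<open>Convexity keeps the segment from \<open>x\<close> to \<open>y\<close> in
  \<open>S\<close>, so local minimality makes the difference quotients along it nonnegative for
  small positive steps; their limit is the directional derivative.\<close>

lemma local_minimizer_gradient_inner_ge:
  fixes f :: "'a::euclidean_space \<Rightarrow> real"
  assumes loc: "local_minimizer f S x" and "convex S" and diff: "f differentiable at x"
    and "y \<in> S"
  shows "0 \<le> gradient f x \<bullet> (y - x)"
proof -
  define h where "h = (\<lambda>\<theta>::real. x + \<theta> *\<^sub>R (y - x))"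
  obtain e where "x \<in> S" and "e > 0" and min: "\<And>z. z \<in> S \<Longrightarrow> dist z x < e \<Longrightarrow> f x \<le> f z"
    using loc by (auto simp: local_minimizer_def)
  have df: "(f has_derivative (\<lambda>v. v \<bullet> gradient f x)) (at (h 0))"
    using GDERIV_gradient[OF diff] by (simp add: gderiv_def h_def)
  have "(h has_derivative (\<lambda>\<theta>. \<theta> *\<^sub>R (y - x))) (at 0)"
    unfolding h_def by (auto intro!: derivative_eq_intros)
  then have "((\<lambda>\<theta>. f (h \<theta>)) has_derivative (\<lambda>\<theta>. (\<theta> *\<^sub>R (y - x)) \<bullet> gradient f x)) (at 0)"
    by (rule has_derivative_compose[where f = h and g = f, OF _ df])
  then have "((\<lambda>\<theta>. f (h \<theta>)) has_real_derivative gradient f x \<bullet> (y - x)) (at 0)"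
    by (simp add: has_field_derivative_def inner_commute mult.commute[of _ "_ \<bullet> _"])
  then have "((\<lambda>\<theta>. (f (h \<theta>) - f x) / \<theta>) \<longlongrightarrow> gradient f x \<bullet> (y - x)) (at_right 0)"
    by (auto simp: has_field_derivative_iff h_def intro: tendsto_mono[OF at_le])
  moreover have "\<forall>\<^sub>F \<theta> in at_right 0. 0 \<le> (f (h \<theta>) - f x) / \<theta>"
  proof -
    have "((\<lambda>\<theta>. dist (h \<theta>) x) \<longlongrightarrow> dist (h 0) x) (at_right 0)"
      unfolding h_def by (intro tendsto_intros)
    then have "\<forall>\<^sub>F \<theta> in at_right 0. dist (h \<theta>) x < e"
      by (rule order_tendstoD) (simp add: h_def \<open>e > 0\<close>)
    moreover have "\<forall>\<^sub>F \<theta> in at_right (0::real). 0 < \<theta> \<and> \<theta> < 1"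
      by (auto simp: eventually_at_right_field intro: exI[of _ 1])
    ultimately show ?thesis
    proof eventually_elim
      case (elim \<theta>)
      have "(1 - \<theta>) *\<^sub>R x + \<theta> *\<^sub>R y \<in> S"
        using \<open>convex S\<close> \<open>x \<in> S\<close> \<open>y \<in> S\<close> elim by (intro convexD) auto
      then have "h \<theta> \<in> S"
        by (simp add: h_def algebra_simps)
      then show ?case
        using min elim by simp
    qed
  qed
  ultimately show ?thesis
    by (rule tendsto_lowerbound) simp
qed

text \<open>A sum rule for normal cones: \<open>- g\<close>, normal to the intersection, splits into
  normals of \<open>X\<close> and \<open>P\<close>. The qualification \<open>qual\<close> is the
  dual form in which Robinson's condition enters.\<close>

lemma normal_cone_inter_decompose:
  fixes g x :: "'a::euclidean_space"
  assumes "convex X" and "convex P" and "x \<in> X" and "x \<in> P"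
    and ge: "\<And>y. y \<in> X \<Longrightarrow> y \<in> P \<Longrightarrow> 0 \<le> g \<bullet> (y - x)"
    and qual: "\<And>n. - n \<in> normal_cone X x \<Longrightarrow> n \<in> normal_cone P x \<Longrightarrow> n = 0"
  obtains m where "m \<in> normal_cone P x" and "- (g + m) \<in> normal_cone X x"
proof -
  \<comment> \<open>The strict inequality makes \<open>E\<close> disjoint from
    \<open>P \<times> {..0}\<close>.\<close>
  define E where "E = {(y, t). y \<in> X \<and> g \<bullet> (y - x) < (t::real)}"
  have "convex E"
  proof (rule convexI)
    fix p q and u v :: real
    assume p: "p \<in> E" and q: "q \<in> E" and uv: "0 \<le> u" "0 \<le> v" "u + v = 1"
    obtain y t z s where pq: "p = (y, t)" "q = (z, s)"
      by (cases p, cases q) auto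
    have yz: "y \<in> X" "z \<in> X" and lt: "g \<bullet> (y - x) < t" "g \<bullet> (z - x) < s"
      using p q by (auto simp: E_def pq)
    have "u *\<^sub>R y + v *\<^sub>R z - x = u *\<^sub>R (y - x) + v *\<^sub>R (z - x)"
      using uv(3) by (simp add: algebra_simps flip: scaleR_add_left)
    then have eq: "g \<bullet> (u *\<^sub>R y + v *\<^sub>R z - x) = u * (g \<bullet> (y - x)) + v * (g \<bullet> (z - x))"
      by (simp add: inner_add_right)
    have "u * (g \<bullet> (y - x)) + v * (g \<bullet> (z - x)) < u * t + v * s"
    proof (cases "u = 0")
      case False
      then show ?thesis
        using uv lt by (intro add_less_le_mono mult_strict_left_mono mult_left_mono) auto
    qed (use uv lt in auto)
    then show "u *\<^sub>R p + v *\<^sub>R q \<in> E"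
      using convexD[OF \<open>convex X\<close> yz uv] eq by (simp add: E_def pq)
  qed
  moreover have "convex (P \<times> {..0::real})"
    using \<open>convex P\<close> by (intro convex_Times) auto
  moreover have "(x, 1) \<in> E" "(x, 0) \<in> P \<times> {..0::real}"
    using \<open>x \<in> X\<close> \<open>x \<in> P\<close> by (auto simp: E_def)
  moreover have "(P \<times> {..0}) \<inter> E = {}"
    using ge by (force simp: E_def)
  ultimately have "\<exists>w c. w \<noteq> 0 \<and> (\<forall>z\<in>P \<times> {..0}. w \<bullet> z \<le> c) \<and> (\<forall>z\<in>E. c \<le> w \<bullet> z)"
    by (intro separating_hyperplane_sets) blast+
  then obtain w c where "w \<noteq> 0" and w: "\<forall>z\<in>P \<times> {..0}. w \<bullet> z \<le> c" "\<forall>z\<in>E. c \<le> w \<bullet> z"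
    by blast
  then obtain n \<alpha> where nz: "(n, \<alpha>) \<noteq> 0" and w_eq: "w = (n, \<alpha>)"
    by (cases w) auto
  have le: "n \<bullet> p + \<alpha> * t \<le> c" if "p \<in> P" "t \<le> 0" for p t
    using w(1) that by (force simp: w_eq)
  have gt: "c \<le> n \<bullet> y + \<alpha> * t" if "y \<in> X" "g \<bullet> (y - x) < t" for y t
    using w(2) that by (force simp: w_eq E_def)
  \<comment> \<open>Letting \<open>t\<close> decrease to the excluded boundary value extends the
    bound to the closed epigraph.\<close>
  have ge_closed: "c \<le> n \<bullet> y + \<alpha> * (g \<bullet> (y - x))" if "y \<in> X" for y
  proof (rule tendsto_lowerbound)
    show "((\<lambda>t. n \<bullet> y + \<alpha> * t) \<longlongrightarrow> n \<bullet> y + \<alpha> * (g \<bullet> (y - x))) (at_right (g \<bullet> (y - x)))"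
      by (intro tendsto_intros)
    show "\<forall>\<^sub>F t in at_right (g \<bullet> (y - x)). c \<le> n \<bullet> y + \<alpha> * t"
      using eventually_at_right_less by eventually_elim (rule gt[OF that])
  qed simp
  \<comment> \<open>The point \<open>(x, 0)\<close> lies in one set and in the closure of the other,
    so the hyperplane passes through it.\<close>
  have c: "c = n \<bullet> x"
    using ge_closed[OF \<open>x \<in> X\<close>] le[OF \<open>x \<in> P\<close>, of 0] by simp
  have "\<alpha> \<ge> 0"
    using gt[OF \<open>x \<in> X\<close>, of 1] c by simp
  have nP: "n \<in> normal_cone P x"
    using le[where t=0] by (auto simp: normal_cone_def c inner_diff_right)
  have nX: "- (\<alpha> *\<^sub>R g + n) \<in> normal_cone X x"
  proof -
    have "- (\<alpha> *\<^sub>R g + n) \<bullet> (y - x) \<le> 0" if "y \<in> X" for y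
      using ge_closed[OF that] by (simp add: c inner_diff_right inner_diff_left algebra_simps)
    then show ?thesis
      by (simp add: normal_cone_def)
  qed
  \<comment> \<open>In a vertical hyperplane \<open>n\<close> would be normal to \<open>P\<close>
    and \<open>- n\<close> to \<open>X\<close>, so \<open>qual\<close> would make
    \<open>(n, \<alpha>)\<close> vanish.\<close>
  have "\<alpha> \<noteq> 0"
    using nz qual[OF _ nP] nX by (auto simp: zero_prod_def)
  with \<open>\<alpha> \<ge> 0\<close> have "\<alpha> > 0"
    by simp
  have cone: "v /\<^sub>R \<alpha> \<in> normal_cone Y x" if "v \<in> normal_cone Y x" for v and Y :: "'a set"
    using that \<open>\<alpha> > 0\<close> by (auto simp: normal_cone_def mult_nonneg_nonpos)
  show thesis
  proof
    show "n /\<^sub>R \<alpha> \<in> normal_cone P x"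
      by (rule cone[OF nP])
    have "(- (\<alpha> *\<^sub>R g + n)) /\<^sub>R \<alpha> = - (g + n /\<^sub>R \<alpha>)"
      using \<open>\<alpha> > 0\<close> by (simp add: scaleR_right_diff_distrib)
    then show "- (g + n /\<^sub>R \<alpha>) \<in> normal_cone X x"
      using cone[OF nX] by simp
  qed
qed

text \<open>Fixing the zero pattern turns the disjunctions
  \<open>x $ i \<in> {0} \<union> {a $ i..b $ i}\<close> into a product of intervals and points,
  which is convex.\<close>

definition sparse_box :: "'n set \<Rightarrow> real ^ 'n \<Rightarrow> real ^ 'n \<Rightarrow> (real ^ 'n) set" where
  "sparse_box J a b = {x. (\<forall>i\<in>J. x $ i \<in> {a $ i..b $ i}) \<and> (\<forall>i\<in>- J. x $ i = 0)}"

lemma convex_sparse_box: "convex (sparse_box J a b)"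
proof -
  have eq: "sparse_box J a b = (\<Inter>i. {x. x $ i \<in> (if i \<in> J then {a $ i..b $ i} else {0})})"
    by (auto simp: sparse_box_def split: if_splits)
  have cvx: "convex {x::real ^ 'n. x $ i \<in> T}" if "convex T" for i T
    using that by (auto simp: convex_def)
  show ?thesis
    unfolding eq by (intro convex_INT cvx) simp
qed

text \<open>Moving coordinate \<open>i\<close> alone to an endpoint of its interval stays in the
  box, which fixes the sign of \<open>m $ i\<close> unless \<open>x $ i\<close> is already that
  endpoint.\<close>

lemma normal_cone_sparse_box_sign:
  assumes m: "m \<in> normal_cone (sparse_box J a b) x" and x: "x \<in> sparse_box J a b"
    and i: "i \<in> J"
  shows "x $ i \<noteq> b $ i \<Longrightarrow> m $ i \<le> 0" and "x $ i \<noteq> a $ i \<Longrightarrow> 0 \<le> m $ i"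
proof -
  have coord: "m $ i * (c - x $ i) \<le> 0" if "c \<in> {a $ i..b $ i}" for c
  proof -
    have "x + axis i (c - x $ i) \<in> sparse_box J a b"
      using x i that by (auto simp: sparse_box_def axis_def)
    then have "m \<bullet> (x + axis i (c - x $ i) - x) \<le> 0"
      using m by (simp only: normal_cone_def mem_Collect_eq)
    then show ?thesis
      by (simp add: inner_axis)
  qed
  have bounds: "a $ i \<le> x $ i" "x $ i \<le> b $ i"
    using x i by (auto simp: sparse_box_def)
  show "m $ i \<le> 0" if "x $ i \<noteq> b $ i"
    using coord[of "b $ i"] bounds that by (auto simp: mult_le_0_iff)
  show "0 \<le> m $ i" if "x $ i \<noteq> a $ i"
    using coord[of "a $ i"] bounds that by (auto simp: mult_le_0_iff)
qed

text \<open>Robinson's condition is applied to a target built from \<open>n\<close> itself. The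
  tangent direction \<open>d\<close> it yields satisfies
  \<open>n \<bullet> d \<le> - (n \<bullet> n)\<close>, whereas normality of \<open>- n\<close>
  gives \<open>0 \<le> n \<bullet> d\<close>.\<close>

lemma robinson_condition_normal_eq_0:
  assumes rob: "robinson_condition X a b x" and x: "x \<in> sparse_box (support x) a b"
    and nX: "- n \<in> normal_cone X x" and nP: "n \<in> normal_cone (sparse_box (support x) a b) x"
  shows "n = 0"
proof -
  let ?J = "support x"
  \<comment> \<open>The first two components \<open>- n\<close> and \<open>n\<close> are opposite, which forces \<open>t = - s\<close>.\<close>
  have "(\<lambda>j\<in>?J. - n $ j, \<lambda>j\<in>?J. n $ j, \<lambda>j\<in>- ?J. - n $ j)
      \<in> (?J \<rightarrow>\<^sub>E UNIV) \<times> (?J \<rightarrow>\<^sub>E UNIV) \<times> (- ?J \<rightarrow>\<^sub>E UNIV)"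
    by auto
  then obtain d s t where d: "d \<in> tangent_cone X x"
    and s: "\<forall>i\<in>{i \<in> ?J. x $ i = b $ i}. s i \<le> 0"
    and t: "\<forall>i\<in>{i \<in> ?J. x $ i = a $ i}. t i \<le> (0::real)"
    and eqs: "(\<lambda>j\<in>?J. - n $ j) = (\<lambda>j\<in>?J. d $ j - s j)"
      "(\<lambda>j\<in>?J. n $ j) = (\<lambda>j\<in>?J. - d $ j - t j)"
      "(\<lambda>j\<in>- ?J. - n $ j) = (\<lambda>j\<in>- ?J. d $ j)"
    using rob unfolding robinson_condition_def Let_def by (elim equalityE) (drule (1) subsetD, unfold mem_Collect_eq prod.inject,
        elim exE conjE, rule that[rotated 3]; assumption)
  have ds: "d $ j = s j - n $ j" "s j = - t j" if "j \<in> ?J" for j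
    using fun_cong[OF eqs(1), of j] fun_cong[OF eqs(2), of j] that by auto
  have dn: "d $ j = - n $ j" if "j \<notin> ?J" for j
    using fun_cong[OF eqs(3), of j] that by auto
  have "n $ j * d $ j \<le> - (n $ j * n $ j)" for j
  proof (cases "j \<in> ?J")
    case True
    \<comment> \<open>A nonzero \<open>n $ j\<close> forces \<open>x $ j\<close> to the endpoint
      matching its sign, and the constraint on \<open>s\<close> or \<open>t\<close> active there
      gives \<open>s j\<close> the opposite sign or zero.\<close>
    have "n $ j * s j \<le> 0"
    proof (cases "n $ j" "0 :: real" rule: linorder_cases)
      case less
      then have "x $ j = a $ j"
        using normal_cone_sparse_box_sign(2)[OF nP x True] by linarith
      then have "0 \<le> s j"
        using t True ds(2)[OF True] by simp
      then show ?thesis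
        using less by (simp add: mult_nonpos_nonneg)
    next
      case greater
      then have "x $ j = b $ j"
        using normal_cone_sparse_box_sign(1)[OF nP x True] by linarith
      then have "s j \<le> 0"
        using s True by simp
      then show ?thesis
        using greater by (simp add: mult_nonneg_nonpos)
    qed simp
    then show ?thesis
      by (simp add: ds(1)[OF True] algebra_simps)
  qed (simp add: dn)
  then have "n \<bullet> d \<le> - (n \<bullet> n)"
    by (simp add: inner_vec_def sum_mono flip: sum_negf)
  moreover have "- n \<bullet> d \<le> 0"
    by (rule normal_cone_inner_tangent_cone_le[OF nX d])
  ultimately have "n \<bullet> n \<le> 0"
    by simp
  then show "n = 0"
    by (metis inner_eq_zero_iff inner_ge_zero order_antisym)
qed

text \<open>Points of the box vanish off \<open>support x\<close>, so they have no more nonzero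
  entries than \<open>x\<close>. This lets local minimality be restricted to a convex set.\<close>

lemma sparse_box_subset_feasible_set:
  assumes "l0_norm x \<le> K"
  shows "X \<inter> sparse_box (support x) a b \<subseteq> feasible_set X K a b"
proof
  fix y assume y: "y \<in> X \<inter> sparse_box (support x) a b"
  then have "support y \<subseteq> support x"
    by (auto simp: sparse_box_def support_def split: if_splits)
  then have "l0_norm y \<le> l0_norm x"
    by (simp add: l0_norm_def card_mono)
  with y assms show "y \<in> feasible_set X K a b"
    by (auto simp: feasible_set_def sparse_box_def split: if_splits)
qed

theorem theorem3p1:
  fixes f :: "real ^ 'n \<Rightarrow> real"
    and X :: "(real ^ 'n) set"
    and K :: nat
    and a b xs :: "real ^ 'n"
  assumes "continuously_differentiable f"
    and "convex_on UNIV f"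
    and "closed X" and "convex X" and "interior X \<noteq> {}"
    and "0 < K" and "K < CARD('n)"
    and "\<And>i. 0 < a $ i \<and> a $ i < b $ i"
    and "local_minimizer f (feasible_set X K a b) xs"
    and "robinson_condition X a b xs"
  shows "\<exists>\<nu> \<eta> \<kappa> :: real ^ 'n.
           0 \<in> (gradient f xs + \<nu> - \<eta> + \<kappa>) +o normal_cone X xs \<and>
           (\<forall>i. 0 \<le> \<nu> $ i \<and> 0 \<le> \<eta> $ i \<and>
                \<nu> $ i * (xs $ i - b $ i) = 0 \<and> \<eta> $ i * (- a $ i + xs $ i) = 0) \<and>
           (\<forall>j\<in>support xs. \<kappa> $ j = 0)"
proof -
  let ?P = "sparse_box (support xs) a b"
  have "xs \<in> feasible_set X K a b"
    using assms(9) by (simp add: local_minimizer_def)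
  then have "xs \<in> X" and l0: "l0_norm xs \<le> K" and xsP: "xs \<in> ?P"
    by (auto simp: feasible_set_def sparse_box_def support_def)
  have "local_minimizer f (X \<inter> ?P) xs"
    using assms(9) \<open>xs \<in> X\<close> xsP sparse_box_subset_feasible_set[OF l0, of X a b]
    unfolding local_minimizer_def by blast
  moreover have "convex (X \<inter> ?P)"
    using assms(4) convex_sparse_box by (rule convex_Int)
  moreover have "f differentiable at xs"
    using assms(1) by (simp add: continuously_differentiable_def)
  ultimately have "0 \<le> gradient f xs \<bullet> (y - xs)" if "y \<in> X" "y \<in> ?P" for y
    using that by (intro local_minimizer_gradient_inner_ge[where S = "X \<inter> ?P"]) auto
  then obtain m where m: "m \<in> normal_cone ?P xs" "- (gradient f xs + m) \<in> normal_cone X xs"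
    using normal_cone_inter_decompose[OF assms(4) convex_sparse_box \<open>xs \<in> X\<close> xsP]
      robinson_condition_normal_eq_0[OF assms(10) xsP] by blast
  \<comment> \<open>Off the support \<open>xs $ i = 0\<close> is neither \<open>a $ i\<close> nor
    \<open>b $ i\<close>, so complementarity forces \<open>\<nu>\<close> and \<open>\<eta>\<close>
    to be zero there and \<open>\<kappa>\<close> takes all of \<open>m\<close>.\<close>
  define \<nu> where "\<nu> = (\<chi> i. if i \<in> support xs then max (m $ i) 0 else 0)"
  define \<eta> where "\<eta> = (\<chi> i. if i \<in> support xs then max (- m $ i) 0 else 0)"
  define \<kappa> where "\<kappa> = (\<chi> i. if i \<in> support xs then 0 else m $ i)"
  have "\<nu> - \<eta> + \<kappa> = m"
    by (simp add: vec_eq_iff \<nu>_def \<eta>_def \<kappa>_def max_def)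
  then have "gradient f xs + \<nu> - \<eta> + \<kappa> = gradient f xs + m"
    by (metis add.assoc add_diff_eq)
  then have "0 = (gradient f xs + \<nu> - \<eta> + \<kappa>) + - (gradient f xs + m)"
    by (metis add.right_inverse)
  then have "0 \<in> (gradient f xs + \<nu> - \<eta> + \<kappa>) +o normal_cone X xs"
    using m(2) unfolding elt_set_plus_def by blast
  \<comment> \<open>On the support, a positive \<open>m $ i\<close> occurs only at
    \<open>b $ i\<close> and a negative one only at \<open>a $ i\<close>.\<close>
  moreover have "\<nu> $ i * (xs $ i - b $ i) = 0 \<and> \<eta> $ i * (- a $ i + xs $ i) = 0" for i
    using normal_cone_sparse_box_sign[OF m(1) xsP, of i] by (auto simp: \<nu>_def \<eta>_def)
  moreover have "0 \<le> \<nu> $ i \<and> 0 \<le> \<eta> $ i" for i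
    by (simp add: \<nu>_def \<eta>_def)
  moreover have "\<forall>j\<in>support xs. \<kappa> $ j = 0"
    by (simp add: \<kappa>_def)
  ultimately show ?thesis
    by blast
qed

end
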